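(* Let $p$ be a prime number and let $g(x) = b_e x^e + b_{e-1} x^{e-1} + \cdots + b_0$, where $b_0 \neq 0$, be a polynomial of degree $e$ with rational coefficients such that $\nu_p(b_e)=0$ and $p$ divides $b_i$ for $0 \leq i \leq e-1$. Let $m_0, m_1, \dots, m_{t-1}, m_t$ be integers, with $m_0 = e$ and $m_t = 0$, such that the successive vertices of the Newton polygon of $g(x)$ with respect to $p$ are given by the set $$\{(0,0), (e-m_1, \nu_p(b_{m_1})), \dots, (e-m_{t-1}, \nu_p(b_{m_{t-1}})), (e, \nu_p(b_0))\},$$ and put $\lambda_i = \frac{\nu_p(b_{m_i}) - \nu_p(b_{m_{i-1}})}{m_{i-1} - m_i}$ for $1 \leq i \leq t$. Assume that $f(x) \in \mathbb{Q}[x]$ is a polynomial of degree $d$ such that the slope $\lambda$ of the first edge of the Newton polygon of $f(x)$ with respect to $p$ is greater than or equal to $\lambda_1$ and that the $p$-adic valuation of the leading coefficient of $f(x)$ is zero. Suppose that one of the following conditions holds: (i) $\nu_p(b_0) < \lambda_1(d + e - 1)$; (ii) $\nu_p(b_0) = \lambda_1(d + e - 1)$, and in addition $\nu_p(f(0)) > d\lambda$ or $\lambda > \lambda_1$. Then for any positive integer $n$, the successive vertices of the Newton polygon of the composition $g(f^n(x))$ with respect to $p$ are given by the set $$\{(0,0), (d^n(e - m_1), \nu_p(b_{m_1})), \dots, (d^n(e - m_{t-1}), \nu_p(b_{m_{t-1}})), (d^n e, \nu_p(b_0))\}.$$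
   Context: $\nu_p$ denotes the $p$-adic valuation on $\mathbb{Q}$, with $\nu_p(0)=+\infty$; for a rational number $b$, "$p$ divides $b$" means $\nu_p(b)>0$. For a polynomial $h(x)=\sum_{i=0}^{N} c_i x^i\in\mathbb{Q}[x]$ of degree $N$ with $h(0)\neq 0$, the Newton polygon of $h$ with respect to $p$ is the polygonal path formed by the lower edges along the convex hull in $\mathbb{R}^2$ of the points $(N-i,\nu_p(c_i))$, $0\le i\le N$ (points with $c_i=0$ are ignored). It is defined only for polynomials with nonzero constant term, so speaking of the Newton polygon of $f$ presupposes $f(0)\ne 0$. Its successive vertices, listed from left to right, are its two endpoints and the points where the slope changes; its edges are the segments between successive vertices, so slopes are strictly increasing from left to right. $f^n$ denotes the $n$-th iterate (composition) of $f$. *)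

theory Defs
  imports "HOL-Analysis.Analysis" "HOL-Computational_Algebra.Computational_Algebra"
begin

definition padic_val :: "nat \<Rightarrow> rat \<Rightarrow> ereal" where
  "padic_val p x =
     (if x = 0 then \<infinity>
      else ereal (real (multiplicity (int p) (fst (quotient_of x)))
                - real (multiplicity (int p) (snd (quotient_of x)))))"

text \<open>Coefficients equal to \<open>0\<close> have valuation \<open>\<infinity>\<close>, so they contribute no point here.\<close>

definition newton_points :: "nat \<Rightarrow> rat poly \<Rightarrow> (real \<times> real) set" where
  "newton_points p h =
     {(x, y). \<exists>i\<le>degree h. x = real (degree h - i) \<and> ereal y = padic_val p (coeff h i)}"

definition newton_polygon :: "nat \<Rightarrow> rat poly \<Rightarrow> (real \<times> real) set" where
  "newton_polygon p h =
     {(x, y). (x, y) \<in> convex hull (newton_points p h) \<and>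
              (\<forall>y'. (x, y') \<in> convex hull (newton_points p h) \<longrightarrow> y \<le> y')}"

definition edge_slope :: "real \<times> real \<Rightarrow> real \<times> real \<Rightarrow> real" where
  "edge_slope v w = (snd w - snd v) / (fst w - fst v)"

text \<open>
  \<open>newton_vertices p h vs\<close>: the Newton polygon of \<open>h\<close> is defined, that is \<open>h(0) \<noteq> 0\<close>, and \<open>vs\<close>
  lists its successive vertices from left to right. The list \<open>vs\<close> is determined by this: the
  segments between successive entries make up the polygon, and since the slopes strictly increase,
  the inner entries are exactly the points where the slope changes. The summand \<open>set vs\<close> matters
  only for constant \<open>h\<close>, whose polygon is a single point without edges.
\<close>

definition newton_vertices :: "nat \<Rightarrow> rat poly \<Rightarrow> (real \<times> real) list \<Rightarrow> bool" where
  "newton_vertices p h vs \<longleftrightarrow>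
     poly h 0 \<noteq> 0 \<and>
     newton_polygon p h =
       set vs \<union> (\<Union>i\<in>{i. Suc i < length vs}. closed_segment (vs ! i) (vs ! Suc i)) \<and>
     (\<forall>i. Suc i < length vs \<longrightarrow> fst (vs ! i) < fst (vs ! Suc i)) \<and>
     (\<forall>i. Suc (Suc i) < length vs \<longrightarrow>
        edge_slope (vs ! i) (vs ! Suc i) < edge_slope (vs ! Suc i) (vs ! Suc (Suc i)))"

text \<open>
  A polygon has a first edge only if it has at least two vertices, so the following implies that
  \<open>h\<close> is not constant (and that \<open>h(0) \<noteq> 0\<close>).
\<close>

definition newton_first_slope :: "nat \<Rightarrow> rat poly \<Rightarrow> real \<Rightarrow> bool" where
  "newton_first_slope p h l \<longleftrightarrow>
     (\<exists>v w vs. newton_vertices p h (v # w # vs) \<and> l = edge_slope v w)"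

definition poly_iterate :: "'a::comm_semiring_1 poly \<Rightarrow> nat \<Rightarrow> 'a poly" where
  "poly_iterate f n = (pcompose f ^^ n) [:0, 1:]"

end

theory Submission imports Defs begin

text \<open>
  Let \<open>w_r(h)\<close> be the minimum over \<open>k\<close> of \<open>\<nu>(c_k) + r k\<close>. For \<open>u \<le> \<lambda>\<close> the hypothesis on \<open>f\<close> says
  \<open>w_u(f) = d u\<close>, so \<open>w_r(f^n) = r d^n\<close> as long as \<open>r d^(n-1) \<le> \<lambda>\<close>. Since every slope of \<open>g\<close> is at
  least \<open>\<lambda>_1\<close> and the last edge has length at least \<open>1\<close>, \<open>\<nu>(b_0) \<ge> \<lambda>_1 (e - 1) + \<lambda>_t\<close>, so either
  condition (i) or (ii) gives \<open>\<lambda>_t \<le> d \<lambda>\<close>. Hence \<open>r = s / d^n\<close> is admissible for every \<open>s\<close> between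
  \<open>\<lambda>_1\<close> and \<open>\<lambda>_t\<close>, and substituting \<open>f^n\<close> for \<open>x\<close> carries \<open>w_s\<close> to \<open>w_r\<close>. Taking \<open>s = \<lambda>_i\<close> puts all points
  of the composition above the stretched polygon. Taking \<open>s\<close> strictly between two successive slopes
  singles out one term of \<open>g\<close>, which shows that the inner vertices are attained. The last vertex is
  attained because \<open>\<nu>(f^n(0)) > \<lambda>_t\<close>; this is where the extra hypothesis in (ii) is needed.
\<close>

section \<open>The valuation\<close>

lemma padic_val_0 [simp]: "padic_val p 0 = \<infinity>"
  by (simp add: padic_val_def)

lemma padic_val_nonzero: "x \<noteq> 0 \<Longrightarrow> padic_val p x = ereal (real_of_ereal (padic_val p x))"
  by (simp add: padic_val_def)

lemma padic_val_1 [simp]: "padic_val p 1 = 0"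
  by (simp add: padic_val_def)

text \<open>\<open>padic_val\<close> is read off from the reduced fraction. Cross-multiplying shows
  that any integer numerator and denominator give the same value, so products and sums can be
  computed without reducing.\<close>

lemma padic_val_of_int_divide:
  assumes p: "prime p" and a: "a \<noteq> 0" and b: "b \<noteq> 0"
  shows "padic_val p (of_int a / of_int b) =
           ereal (real (multiplicity (int p) a) - real (multiplicity (int p) b))"
proof -
  obtain c k where ck: "quotient_of (of_int a / of_int b) = (c, k)" by force
  have k: "k > 0" using quotient_of_denom_pos[OF ck] .
  have eq: "of_int a / of_int b = (of_int c / of_int k :: rat)" using quotient_of_div[OF ck] .
  have "(of_int (a * k) :: rat) = of_int (c * b)"
    using eq b k by (simp add: field_simps)
  then have ak: "a * k = c * b" by (simp only: of_int_eq_iff)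
  have c: "c \<noteq> 0" using ak a k by auto
  have pe: "prime_elem (int p)" using p by (simp add: prime_imp_prime_elem)
  have "multiplicity (int p) a + multiplicity (int p) k = multiplicity (int p) c + multiplicity (int p) b"
    using prime_elem_multiplicity_mult_distrib[OF pe, of a k]
      prime_elem_multiplicity_mult_distrib[OF pe, of c b] ak a b c k by simp
  then have "real (multiplicity (int p) a) + real (multiplicity (int p) k)
      = real (multiplicity (int p) c) + real (multiplicity (int p) b)"
    by (metis of_nat_add)
  then show ?thesis using a b by (simp add: padic_val_def ck)
qed

lemma rat_as_quotient: obtains a b where "(x::rat) = of_int a / of_int b" "b \<noteq> 0"
proof -
  obtain c k where ck: "quotient_of x = (c, k)" by force
  show ?thesis
    using that[of c k] quotient_of_denom_pos[OF ck] quotient_of_div[OF ck] by simp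
qed

lemma padic_val_mult:
  assumes p: "prime p"
  shows "padic_val p (x * y) = padic_val p x + padic_val p y"
proof (cases "x = 0 \<or> y = 0")
  case True
  then show ?thesis by (auto simp: padic_val_def)
next
  case False
  obtain a b where x: "x = of_int a / of_int b" "b \<noteq> 0" by (rule rat_as_quotient)
  obtain c k where y: "y = of_int c / of_int k" "k \<noteq> 0" by (rule rat_as_quotient)
  have ac: "a \<noteq> 0" "c \<noteq> 0" using False x y by auto
  have pe: "prime_elem (int p)" using p by (simp add: prime_imp_prime_elem)
  have "padic_val p (x * y) = padic_val p (of_int (a * c) / of_int (b * k))"
    using x y by simp
  also have "\<dots> = ereal (real (multiplicity (int p) (a * c)) - real (multiplicity (int p) (b * k)))"
    by (rule padic_val_of_int_divide) (use p x y ac in auto)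
  finally show ?thesis
    using x y ac p by (simp add: padic_val_of_int_divide prime_elem_multiplicity_mult_distrib[OF pe])
qed

lemma padic_val_add:
  assumes p: "prime p"
  shows "min (padic_val p x) (padic_val p y) \<le> padic_val p (x + y)"
proof (cases "x = 0 \<or> y = 0 \<or> x + y = 0")
  case True
  then show ?thesis by auto
next
  case False
  obtain a b where x: "x = of_int a / of_int b" "b \<noteq> 0" by (rule rat_as_quotient)
  obtain c k where y: "y = of_int c / of_int k" "k \<noteq> 0" by (rule rat_as_quotient)
  \<comment> \<open>Over a common denominator only the numerators matter, and a power of
    \<open>p\<close> dividing both of them divides their sum.\<close>
  define A B C where "A = a * k" and "B = c * b" and "C = b * k"
  have xA: "x = of_int A / of_int C" and yB: "y = of_int B / of_int C"
    using x y by (simp_all add: A_def B_def C_def)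
  have C: "C \<noteq> 0" using x y by (simp add: C_def)
  have xy: "x + y = of_int (A + B) / of_int C"
    by (simp add: xA yB add_divide_distrib)
  have nz: "A \<noteq> 0" "B \<noteq> 0" "A + B \<noteq> 0"
    using False xA yB xy by auto
  let ?n = "min (multiplicity (int p) A) (multiplicity (int p) B)"
  have "int p ^ ?n dvd A + B"
    by (intro dvd_add multiplicity_dvd') simp_all
  then have "?n \<le> multiplicity (int p) (A + B)"
    using nz p by (intro multiplicity_geI) (auto dest: prime_gt_1_nat)
  then have "real ?n \<le> real (multiplicity (int p) (A + B))" by (rule of_nat_mono)
  then show ?thesis
    unfolding xy unfolding xA yB
    by (simp add: padic_val_of_int_divide p C nz del: of_int_add)
      (auto simp: min_def split: if_splits)
qed

lemma padic_val_uminus: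
  assumes p: "prime p"
  shows "padic_val p (- x) = padic_val p x"
proof (cases "x = 0")
  case False
  have "padic_val p (-1) + padic_val p (-1) = padic_val p (-1 * -1)"
    using padic_val_mult[OF p, of "-1" "-1"] by simp
  then have "padic_val p (-1) = 0"
    by (simp add: padic_val_def)
  then show ?thesis using padic_val_mult[OF p, of "-1" x] by simp
qed simp

lemma padic_val_add_eq:
  assumes p: "prime p" and less: "padic_val p x < padic_val p y"
  shows "padic_val p (x + y) = padic_val p x"
proof (rule antisym)
  show "padic_val p x \<le> padic_val p (x + y)"
    using padic_val_add[OF p, of x y] less by (simp add: min_absorb1)
  \<comment> \<open>Here \<open>x\<close> is written as \<open>(x + y) + (- y)\<close>; the minimum
    cannot be the valuation of \<open>y\<close>, which exceeds that of \<open>x\<close>.\<close>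
  have "min (padic_val p (x + y)) (padic_val p y) \<le> padic_val p x"
    using padic_val_add[OF p, of "x + y" "- y"] by (simp add: padic_val_uminus[OF p])
  then show "padic_val p (x + y) \<le> padic_val p x"
    using less by (auto simp: min_def split: if_splits)
qed

lemma padic_val_sum_ge:
  assumes p: "prime p" and "\<And>i. i \<in> A \<Longrightarrow> s \<le> padic_val p (h i)"
  shows "s \<le> padic_val p (sum h A)"
  using assms(2)
proof (induction A rule: infinite_finite_induct)
  case (insert i A)
  then have "s \<le> min (padic_val p (h i)) (padic_val p (sum h A))" by simp
  also have "\<dots> \<le> padic_val p (h i + sum h A)" by (rule padic_val_add[OF p])
  finally show ?case using insert.hyps by simp
qed simp_all

text \<open>A real bound \<open>s\<close> keeps the strict inequality true for the empty sum, whose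
  valuation is \<infinity>.\<close>

lemma padic_val_sum_gt:
  assumes p: "prime p" and "\<And>i. i \<in> A \<Longrightarrow> ereal s < padic_val p (h i)"
  shows "ereal s < padic_val p (sum h A)"
  using assms(2)
proof (induction A rule: infinite_finite_induct)
  case (insert i A)
  then have "ereal s < min (padic_val p (h i)) (padic_val p (sum h A))" by simp
  also have "\<dots> \<le> padic_val p (h i + sum h A)" by (rule padic_val_add[OF p])
  finally show ?case using insert.hyps by simp
qed simp_all

lemma padic_val_power_ge:
  assumes p: "prime p" and "ereal s \<le> padic_val p x"
  shows "ereal (real k * s) \<le> padic_val p (x ^ k)"
proof (induction k)
  case (Suc k)
  have "ereal (real (Suc k) * s) = ereal s + ereal (real k * s)"
    by (simp add: algebra_simps)
  also have "\<dots> \<le> padic_val p x + padic_val p (x ^ k)"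
    using assms(2) Suc by (rule add_mono)
  finally show ?case by (simp add: padic_val_mult[OF p])
qed simp

lemma padic_val_power_unit:
  assumes "prime p" and "padic_val p x = 0"
  shows "padic_val p (x ^ k) = 0"
  by (induction k) (simp_all add: padic_val_mult assms)


section \<open>Lower bounds for the Gauss valuations\<close>

text \<open>This is \<open>w_r(h) \<ge> s\<close>, stated without forming the minimum.
  Geometrically, all Newton points lie on or above a line of slope \<open>r\<close>. Indices beyond
  the degree impose nothing, since the zero coefficient has valuation \<infinity>.\<close>

definition gauss_bound :: "nat \<Rightarrow> real \<Rightarrow> real \<Rightarrow> rat poly \<Rightarrow> bool" where
  "gauss_bound p r s h \<longleftrightarrow> (\<forall>k. ereal (s - r * real k) \<le> padic_val p (coeff h k))"

text \<open>The easy half of the multiplicativity of Gauss valuations: in each term of the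
  convolution, \<open>r k\<close> splits as \<open>r i + r (k - i)\<close>.\<close>

lemma gauss_bound_mult:
  assumes p: "prime p" and a: "gauss_bound p r s a" and b: "gauss_bound p r u b"
  shows "gauss_bound p r (s + u) (a * b)"
  unfolding gauss_bound_def
proof
  fix k
  show "ereal (s + u - r * real k) \<le> padic_val p (coeff (a * b) k)"
    unfolding coeff_mult
  proof (rule padic_val_sum_ge[OF p])
    fix i assume "i \<in> {..k}"
    then have "ereal (s + u - r * real k) = ereal (s - r * real i) + ereal (u - r * real (k - i))"
      by (simp add: algebra_simps of_nat_diff)
    also have "\<dots> \<le> padic_val p (coeff a i) + padic_val p (coeff b (k - i))"
      using a b by (intro add_mono) (auto simp: gauss_bound_def)
    finally show "ereal (s + u - r * real k) \<le> padic_val p (coeff a i * coeff b (k - i))"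
      by (simp add: padic_val_mult[OF p])
  qed
qed

lemma gauss_bound_power:
  assumes p: "prime p" and a: "gauss_bound p r s a"
  shows "gauss_bound p r (real j * s) (a ^ j)"
proof (induction j)
  case 0
  then show ?case by (auto simp: gauss_bound_def coeff_1)
next
  case (Suc j)
  from gauss_bound_mult[OF p a this] show ?case by (simp add: algebra_simps)
qed

lemma coeff_pcompose:
  fixes h F :: "'a::comm_semiring_1 poly"
  shows "coeff (pcompose h F) k = (\<Sum>j\<le>degree h. coeff h j * coeff (F ^ j) k)"
proof -
  have "pcompose h F = (\<Sum>j\<le>degree h. smult (coeff h j) (F ^ j))"
    by (simp add: pcompose_altdef poly_altdef degree_map_poly coeff_map_poly)
  then show ?thesis by (simp add: coeff_sum)
qed

text \<open>The lower bound \<open>u\<close> for \<open>F\<close> serves as the weight for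
  \<open>h\<close>: the bound \<open>j u\<close> for \<open>F ^ j\<close> cancels the loss
  \<open>u j\<close> in the coefficient of index \<open>j\<close>.\<close>

lemma gauss_bound_pcompose:
  assumes p: "prime p" and h: "gauss_bound p u s h" and F: "gauss_bound p r u F"
  shows "gauss_bound p r s (pcompose h F)"
  unfolding gauss_bound_def coeff_pcompose
proof (intro allI padic_val_sum_ge[OF p])
  fix k j
  have "ereal (s - r * real k) = ereal (s - u * real j) + ereal (real j * u - r * real k)"
    by simp
  also have "\<dots> \<le> padic_val p (coeff h j) + padic_val p (coeff (F ^ j) k)"
    using h gauss_bound_power[OF p F, of j] by (intro add_mono) (auto simp: gauss_bound_def)
  finally show "ereal (s - r * real k) \<le> padic_val p (coeff h j * coeff (F ^ j) k)"
    by (simp add: padic_val_mult[OF p])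
qed

section \<open>Degree, leading coefficient and Gauss bounds of iterates\<close>

lemma poly_iterate_0: "poly_iterate f 0 = [:0, 1:]"
  and poly_iterate_Suc: "poly_iterate f (Suc n) = pcompose f (poly_iterate f n)"
  by (simp_all add: poly_iterate_def)

lemma degree_poly_iterate:
  fixes f :: "rat poly"
  shows "degree (poly_iterate f n) = degree f ^ n"
  by (induction n) (simp_all add: poly_iterate_0 poly_iterate_Suc degree_pcompose)

lemma padic_val_lead_coeff_poly_iterate:
  assumes p: "prime p" and d: "degree f \<ge> 1" and u: "padic_val p (lead_coeff f) = 0"
  shows "padic_val p (lead_coeff (poly_iterate f n)) = 0"
proof (induction n)
  case (Suc n)
  have "degree (poly_iterate f n) > 0"
    using d by (simp add: degree_poly_iterate)
  then have "lead_coeff (poly_iterate f (Suc n)) = lead_coeff f * lead_coeff (poly_iterate f n) ^ degree f"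
    unfolding poly_iterate_Suc by (rule lead_coeff_comp)
  then show ?case
    using Suc u by (simp add: padic_val_mult[OF p] padic_val_power_unit[OF p])
qed (simp add: poly_iterate_0)

text \<open>Each further composition with \<open>f\<close> turns a bound \<open>u\<close> into
  \<open>d u\<close>, provided \<open>u \<le> lam\<close>; the bounds met on the way are
  \<open>r d^k\<close> with \<open>k < n\<close>.\<close>

lemma gauss_bound_poly_iterate:
  assumes p: "prime p"
    and f: "\<And>u. u \<le> lam \<Longrightarrow> gauss_bound p u (real d * u) f"
    and r: "\<And>k. k < n \<Longrightarrow> r * real d ^ k \<le> lam"
  shows "gauss_bound p r (r * real d ^ n) (poly_iterate f n)"
  using r
proof (induction n)
  case 0
  then show ?case
    by (auto simp: gauss_bound_def poly_iterate_0 coeff_pCons split: nat.split)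
next
  case (Suc n)
  have "gauss_bound p r (r * real d ^ n) (poly_iterate f n)"
    using Suc by simp
  moreover have "gauss_bound p (r * real d ^ n) (real d * (r * real d ^ n)) f"
    using Suc.prems[of n] f by simp
  ultimately show ?case
    unfolding poly_iterate_Suc using gauss_bound_pcompose[OF p] by (simp add: mult_ac)
qed

section \<open>Values at a point and the orbit of 0\<close>

lemma padic_val_poly_ge:
  assumes p: "prime p" and f: "gauss_bound p u s f" and c: "ereal u \<le> padic_val p c"
  shows "ereal s \<le> padic_val p (poly f c)"
  unfolding poly_altdef
proof (rule padic_val_sum_ge[OF p])
  fix i
  have "ereal s = ereal (s - u * real i) + ereal (real i * u)" by simp
  also have "\<dots> \<le> padic_val p (coeff f i) + padic_val p (c ^ i)"
    using f padic_val_power_ge[OF p c, of i] by (intro add_mono) (auto simp: gauss_bound_def)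
  finally show "ereal s \<le> padic_val p (coeff f i * c ^ i)" by (simp add: padic_val_mult[OF p])
qed

text \<open>At a point of valuation above the weight \<open>u\<close>, every term of positive index
  gains strictly, so the constant term can decide the valuation of the value.\<close>

lemma padic_val_sum_higher_terms:
  assumes p: "prime p" and h: "gauss_bound p u s h" and c: "ereal u < padic_val p c"
  shows "ereal s < padic_val p (\<Sum>j\<in>{1..degree h}. coeff h j * c ^ j)"
proof (rule padic_val_sum_gt[OF p])
  fix j assume j: "j \<in> {1..degree h}"
  \<comment> \<open>The valuation of \<open>c\<close> may be \<infinity>, so a real number in
    between replaces it.\<close>
  obtain u' where u': "u < u'" "ereal u' \<le> padic_val p c"
    using ereal_dense2[OF c] by (auto intro: less_imp_le)
  have "u * real j < u' * real j" using u'(1) j by (intro mult_strict_right_mono) auto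
  then have "ereal s < ereal (s - u * real j) + ereal (real j * u')"
    by (simp add: mult.commute)
  also have "\<dots> \<le> padic_val p (coeff h j) + padic_val p (c ^ j)"
    using h padic_val_power_ge[OF p u'(2), of j] by (intro add_mono) (auto simp: gauss_bound_def)
  finally show "ereal s < padic_val p (coeff h j * c ^ j)" by (simp add: padic_val_mult[OF p])
qed

lemma poly_split_constant: "poly h c = coeff h 0 + (\<Sum>j\<in>{1..degree h}. coeff h j * c ^ j)"
  for c :: "'a::comm_semiring_1"
proof -
  have "{..degree h} = insert 0 {1..degree h}" by auto
  then show ?thesis by (simp add: poly_altdef)
qed

lemma padic_val_poly_eq_constant:
  assumes p: "prime p" and h: "gauss_bound p u s h" and c: "ereal u < padic_val p c"
    and s: "padic_val p (coeff h 0) = ereal s"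
  shows "padic_val p (poly h c) = ereal s"
  using padic_val_add_eq[OF p, of "coeff h 0"] padic_val_sum_higher_terms[OF p h c] s
  by (simp add: poly_split_constant)

lemma padic_val_poly_gt:
  assumes p: "prime p" and h: "gauss_bound p u s h" and c: "ereal u < padic_val p c"
    and s: "ereal s < padic_val p (coeff h 0)"
  shows "ereal s < padic_val p (poly h c)"
proof -
  have "ereal s < min (padic_val p (coeff h 0)) (padic_val p (\<Sum>j\<in>{1..degree h}. coeff h j * c ^ j))"
    using padic_val_sum_higher_terms[OF p h c] s by simp
  also have "\<dots> \<le> padic_val p (poly h c)"
    unfolding poly_split_constant by (rule padic_val_add[OF p])
  finally show ?thesis .
qed

text \<open>Since \<open>lam \<le> d lam\<close>, the orbit of 0 never leaves the disc of valuation
  at least \<open>lam\<close>; the last application of \<open>f\<close> then yields the factor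
  \<open>d\<close>.\<close>

lemma padic_val_poly_iterate_0_ge:
  assumes p: "prime p" and f: "gauss_bound p lam (real d * lam) f" and d: "d \<ge> 1" and lam: "lam \<ge> 0"
    and n: "n \<ge> 1"
  shows "ereal (real d * lam) \<le> padic_val p (poly (poly_iterate f n) 0)"
proof -
  have dl: "lam \<le> real d * lam" using d lam by (simp add: mult_le_cancel_right1)
  have "ereal lam \<le> padic_val p (poly (poly_iterate f k) 0)" for k
  proof (induction k)
    case (Suc k)
    have "ereal lam \<le> ereal (real d * lam)" using dl by simp
    also have "\<dots> \<le> padic_val p (poly f (poly (poly_iterate f k) 0))"
      by (rule padic_val_poly_ge[OF p f Suc])
    finally show ?case by (simp add: poly_iterate_Suc poly_pcompose)
  qed (simp add: poly_iterate_0)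
  from padic_val_poly_ge[OF p f this, of "n - 1"] show ?thesis
    using n poly_iterate_Suc[of f "n - 1"] by (simp add: poly_pcompose)
qed

text \<open>Serves the case where the last slope of \<open>g\<close> may equal \<open>d lam\<close>.
  The orbit starts at 0, of valuation \<infinity>, and the bound on \<open>f(0)\<close> keeps it
  strictly above \<open>lam\<close>.\<close>

lemma padic_val_poly_iterate_0_gt:
  assumes p: "prime p" and f: "gauss_bound p lam (real d * lam) f" and d: "d \<ge> 1" and lam: "lam \<ge> 0"
    and f0: "ereal (real d * lam) < padic_val p (coeff f 0)" and n: "n \<ge> 1"
  shows "ereal (real d * lam) < padic_val p (poly (poly_iterate f n) 0)"
proof -
  have dl: "lam \<le> real d * lam" using d lam by (simp add: mult_le_cancel_right1)
  have "ereal lam < padic_val p (poly (poly_iterate f k) 0)" for k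
  proof (induction k)
    case (Suc k)
    have "ereal lam \<le> ereal (real d * lam)" using dl by simp
    also have "\<dots> < padic_val p (poly f (poly (poly_iterate f k) 0))"
      by (rule padic_val_poly_gt[OF p f Suc f0])
    finally show ?case by (simp add: poly_iterate_Suc poly_pcompose)
  qed (simp add: poly_iterate_0)
  from padic_val_poly_gt[OF p f this f0, of "n - 1"] show ?thesis
    using n poly_iterate_Suc[of f "n - 1"] by (simp add: poly_pcompose)
qed

text \<open>If the weight \<open>r\<close> singles out the term of index \<open>k\<close> in \<open>h\<close>, then only that term contributes
  to the leading order of the coefficient of index \<open>D k\<close> in the composition.\<close>

lemma padic_val_coeff_pcompose_eq:
  assumes p: "prime p" and D: "degree F = D" and u: "padic_val p (lead_coeff F) = 0"
    and F: "gauss_bound p r (r * real D) F"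
    and k: "k \<le> degree h" "padic_val p (coeff h k) = ereal s"
    and h: "\<And>j. j \<le> degree h \<Longrightarrow> j \<noteq> k \<Longrightarrow>
              ereal (s + r * real D * (real k - real j)) < padic_val p (coeff h j)"
  shows "padic_val p (coeff (pcompose h F) (D * k)) = ereal s"
proof -
  let ?T = "\<lambda>j. coeff h j * coeff (F ^ j) (D * k)"
  have lead: "coeff (F ^ k) (D * k) = lead_coeff F ^ k"
  proof -
    have "F \<noteq> 0" using u by auto
    then show ?thesis
      using lead_coeff_power[of F k] degree_power_eq[of F k] D by (simp add: mult.commute)
  qed
  have main: "padic_val p (?T k) = ereal s"
    by (simp add: lead padic_val_mult[OF p] padic_val_power_unit[OF p u] k)
  have "ereal s < padic_val p (\<Sum>j\<in>{..degree h} - {k}. ?T j)"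
  proof (rule padic_val_sum_gt[OF p])
    fix j assume j: "j \<in> {..degree h} - {k}"
    \<comment> \<open>\<open>- w\<close> is the bound that the weight \<open>r\<close> gives for the
      coefficient of index \<open>D k\<close> in \<open>F ^ j\<close>, while \<open>s + w\<close> is
      the strict bound assumed for \<open>coeff h j\<close>.\<close>
    define w where "w = r * real D * (real k - real j)"
    have "ereal s = ereal (- w) + ereal (s + w)" by simp
    also have "\<dots> < ereal (- w) + padic_val p (coeff h j)"
      using h[of j] j unfolding w_def by (intro ereal_less_add) auto
    also have "\<dots> = padic_val p (coeff h j) + ereal (- w)" by (rule add.commute)
    also have "\<dots> \<le> padic_val p (coeff h j) + padic_val p (coeff (F ^ j) (D * k))"
    proof (rule add_left_mono)
      have "- w = real j * (r * real D) - r * real (D * k)" by (simp add: w_def algebra_simps)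
      then show "ereal (- w) \<le> padic_val p (coeff (F ^ j) (D * k))"
        using gauss_bound_power[OF p F, of j, unfolded gauss_bound_def, rule_format, of "D * k"]
        by simp
    qed
    finally show "ereal s < padic_val p (?T j)" by (simp add: padic_val_mult[OF p])
  qed
  then have "padic_val p (?T k + (\<Sum>j\<in>{..degree h} - {k}. ?T j)) = ereal s"
    using padic_val_add_eq[OF p, of "?T k"] main by simp
  then show ?thesis
    using k by (simp add: coeff_pcompose sum.remove[of "{..degree h}" k])
qed


section \<open>Newton polygons and supporting lines\<close>

lemma hull_above_line:
  assumes "\<And>P. P \<in> S \<Longrightarrow> a * fst P + b \<le> snd P" and "Q \<in> convex hull S"
  shows "a * fst Q + b \<le> (snd Q :: real)"
proof -
  have "convex {P. b \<le> inner (- a, 1) P}" by (rule convex_halfspace_ge)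
  also have "{P. b \<le> inner (- a, 1) P} = {P. a * fst P + b \<le> snd P}"
    by (auto simp: inner_prod_def)
  finally have "convex hull S \<subseteq> {P. a * fst P + b \<le> snd P}"
    using assms(1) by (intro hull_minimal) auto
  then show ?thesis using assms(2) by auto
qed

lemma hull_fst_bounds:
  fixes S :: "(real \<times> real) set"
  assumes "\<And>P. P \<in> S \<Longrightarrow> a \<le> fst P \<and> fst P \<le> b" and "Q \<in> convex hull S"
  shows "a \<le> fst Q \<and> fst Q \<le> b"
proof -
  have "convex {P :: real \<times> real. a \<le> fst P \<and> fst P \<le> b}"
  proof -
    have eq: "{P :: real \<times> real. a \<le> fst P \<and> fst P \<le> b} = {a..b} \<times> UNIV" by auto
    show ?thesis unfolding eq by (intro convex_Times convex_real_interval convex_UNIV)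
  qed
  then have "convex hull S \<subseteq> {P. a \<le> fst P \<and> fst P \<le> b}"
    using assms(1) by (intro hull_minimal) auto
  then show ?thesis using assms(2) by auto
qed

lemma closed_segment_on_line:
  assumes "Q \<in> closed_segment v w" and "fst v < fst w"
  shows "snd Q = snd v + edge_slope v w * (fst Q - fst v)"
    and "fst v \<le> fst Q" and "fst Q \<le> fst w"
proof -
  obtain u where u: "0 \<le> u" "u \<le> 1" "Q = (1 - u) *\<^sub>R v + u *\<^sub>R w"
    using assms(1) by (auto simp: in_segment)
  have f: "fst Q = fst v + u * (fst w - fst v)" and s: "snd Q = snd v + u * (snd w - snd v)"
    unfolding u(3) by (simp_all add: algebra_simps)
  show "snd Q = snd v + edge_slope v w * (fst Q - fst v)"
    using assms(2) by (simp add: f s edge_slope_def)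
  show "fst v \<le> fst Q" unfolding f using u(1,2) assms(2) by simp
  have "u * (fst w - fst v) \<le> 1 * (fst w - fst v)"
    using u assms(2) by (intro mult_right_mono) auto
  then show "fst Q \<le> fst w" by (simp add: f)
qed

lemma closed_segment_above:
  fixes v w :: "real \<times> real"
  assumes "fst v < fst w" and "fst v \<le> x" and "x \<le> fst w"
  shows "(x, snd v + edge_slope v w * (x - fst v)) \<in> closed_segment v w"
proof -
  define u where "u = (x - fst v) / (fst w - fst v)"
  have u: "0 \<le> u" "u \<le> 1" using assms by (auto simp: u_def)
  have "u * (fst w - fst v) = x - fst v" using assms(1) by (simp add: u_def)
  moreover have "edge_slope v w * (x - fst v) = u * (snd w - snd v)"
    by (simp add: edge_slope_def u_def)
  ultimately have "(x, snd v + edge_slope v w * (x - fst v)) = (1 - u) *\<^sub>R v + u *\<^sub>R w"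
    by (simp add: prod_eq_iff algebra_simps)
  then show ?thesis using u by (auto simp: in_segment)
qed

section \<open>Edges as supporting lines\<close>

lemma newton_vertices_edge_subset:
  assumes "newton_vertices p h vs" and "Suc i < length vs"
  shows "closed_segment (vs ! i) (vs ! Suc i) \<subseteq> newton_polygon p h"
  using assms unfolding newton_vertices_def by blast

lemma newton_vertices_fst_less:
  assumes "newton_vertices p h vs" and "Suc i < length vs"
  shows "fst (vs ! i) < fst (vs ! Suc i)"
  using assms unfolding newton_vertices_def by blast

text \<open>The chord from a point below the line of an edge to the farther end of that edge
  passes below the midpoint of the edge.\<close>

lemma newton_vertices_above_edge:
  assumes nv: "newton_vertices p h vs" and i: "Suc i < length vs" and Q: "Q \<in> newton_points p h"
  shows "snd (vs ! i) + edge_slope (vs ! i) (vs ! Suc i) * (fst Q - fst (vs ! i)) \<le> snd Q"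
proof (rule ccontr)
  define A B s where "A = vs ! i" and "B = vs ! Suc i" and "s = edge_slope A B"
  assume "\<not> ?thesis"
  then have below: "snd Q < snd A + s * (fst Q - fst A)" by (simp add: A_def B_def s_def)
  have AB: "fst A < fst B" using newton_vertices_fst_less[OF nv i] by (simp add: A_def B_def)
  have seg: "closed_segment A B \<subseteq> newton_polygon p h"
    using newton_vertices_edge_subset[OF nv i] by (simp add: A_def B_def)
  have AH: "A \<in> convex hull newton_points p h" and BH: "B \<in> convex hull newton_points p h"
    using seg by (auto simp: newton_polygon_def)
  have QH: "Q \<in> convex hull newton_points p h" using Q by (rule hull_inc)
  define c where "c = (fst A + fst B) / 2"
  have c: "fst A < c" "c < fst B" using AB by (auto simp: c_def)
  have M: "(c, snd A + s * (c - fst A)) \<in> newton_polygon p h"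
    using seg closed_segment_above[OF AB, of c] c by (auto simp: s_def)
  have Bs: "snd B = snd A + s * (fst B - fst A)" using AB by (simp add: s_def edge_slope_def)
  \<comment> \<open>The end of the edge on the other side of \<open>c\<close> from \<open>Q\<close>,
    so that the chord from \<open>E\<close> to \<open>Q\<close> crosses the vertical line over
    \<open>c\<close>.\<close>
  define E where "E = (if c \<le> fst Q then A else B)"
  have EH: "E \<in> convex hull newton_points p h" using AH BH by (simp add: E_def)
  have Es: "snd E = snd A + s * (fst E - fst A)" using Bs by (simp add: E_def)
  have EQ: "fst E \<noteq> fst Q" using c by (auto simp: E_def)
  define u where "u = (c - fst E) / (fst Q - fst E)"
  \<comment> \<open>Positivity gives \<open>Q\<close> a real share in the crossing point
    \<open>R\<close>, which therefore falls strictly below the edge.\<close>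
  have u: "0 < u" "u \<le> 1"
    using c by (auto simp: u_def E_def divide_simps)
  have uc: "c = (1 - u) * fst E + u * fst Q"
  proof -
    have "u * (fst Q - fst E) = c - fst E" using EQ by (simp add: u_def)
    then show ?thesis by (simp add: algebra_simps)
  qed
  define R where "R = (1 - u) *\<^sub>R E + u *\<^sub>R Q"
  have RH: "R \<in> convex hull newton_points p h"
    unfolding R_def using EH QH u by (intro convexD_alt convex_convex_hull) auto
  have Rc: "R = (c, snd R)" by (simp add: R_def uc prod_eq_iff)
  have "u * snd Q < u * (snd A + s * (fst Q - fst A))"
    using below u by simp
  then have "snd R < (1 - u) * (snd A + s * (fst E - fst A)) + u * (snd A + s * (fst Q - fst A))"
    by (simp add: R_def Es)
  also have "\<dots> = snd A + s * (c - fst A)"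
    by (simp add: uc algebra_simps)
  finally have "snd R < snd A + s * (c - fst A)" .
  moreover have "snd A + s * (c - fst A) \<le> snd R"
    using M RH Rc by (auto simp: newton_polygon_def)
  ultimately show False by simp
qed

text \<open>A discrete intermediate value argument; it locates an edge over a given
  abscissa.\<close>

lemma exists_consecutive_between:
  fixes a :: "nat \<Rightarrow> 'a::linorder"
  assumes "a 0 \<le> x" and "x \<le> a k" and "k \<ge> 1"
  obtains i where "i < k" "a i \<le> x" "x \<le> a (Suc i)"
  using assms
proof (induction k arbitrary: thesis)
  case (Suc k)
  show ?case
  proof (cases "k \<ge> 1 \<and> x \<le> a k")
    case True
    then obtain i where "i < k" "a i \<le> x" "x \<le> a (Suc i)"
      using Suc.IH Suc.prems by blast
    then show ?thesis using Suc.prems(1)[of i] by simp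
  next
    case False
    then have "a k \<le> x" using Suc.prems by (cases "k = 0") auto
    then show ?thesis using Suc.prems(1)[of k] Suc.prems by simp
  qed
qed simp

text \<open>The edges lie in the hull because their ends are Newton points, and nothing in the hull
  is below their lines. They cover the whole range of abscissae, so they form the entire lower
  boundary.\<close>

lemma newton_verticesI:
  assumes h0: "poly h 0 \<noteq> 0" and len: "length vs \<ge> 2"
    and vs: "set vs \<subseteq> newton_points p h"
    and range: "\<And>P. P \<in> newton_points p h \<Longrightarrow> fst (vs ! 0) \<le> fst P \<and> fst P \<le> fst (vs ! (length vs - 1))"
    and above: "\<And>i P. Suc i < length vs \<Longrightarrow> P \<in> newton_points p h \<Longrightarrow>
       snd (vs ! i) + edge_slope (vs ! i) (vs ! Suc i) * (fst P - fst (vs ! i)) \<le> snd P"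
    and inc: "\<And>i. Suc i < length vs \<Longrightarrow> fst (vs ! i) < fst (vs ! Suc i)"
    and slopes: "\<And>i. Suc (Suc i) < length vs \<Longrightarrow>
        edge_slope (vs ! i) (vs ! Suc i) < edge_slope (vs ! Suc i) (vs ! Suc (Suc i))"
  shows "newton_vertices p h vs"
proof -
  let ?H = "convex hull newton_points p h"
  let ?U = "\<Union>i\<in>{i. Suc i < length vs}. closed_segment (vs ! i) (vs ! Suc i)"
  have aboveH: "snd (vs ! i) + edge_slope (vs ! i) (vs ! Suc i) * (fst P - fst (vs ! i)) \<le> snd P"
    if i: "Suc i < length vs" and P: "P \<in> ?H" for i P
  proof -
    let ?s = "edge_slope (vs ! i) (vs ! Suc i)"
    have "?s * fst P + (snd (vs ! i) - ?s * fst (vs ! i)) \<le> snd P"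
      by (rule hull_above_line[OF _ P]) (use above[OF i] in \<open>simp add: algebra_simps\<close>)
    then show ?thesis by (simp add: algebra_simps)
  qed
  have segH: "closed_segment (vs ! i) (vs ! Suc i) \<subseteq> ?H" if i: "Suc i < length vs" for i
    using i vs by (intro closed_segment_subset convex_convex_hull) (auto intro!: hull_inc)
  have segP: "closed_segment (vs ! i) (vs ! Suc i) \<subseteq> newton_polygon p h" if i: "Suc i < length vs" for i
  proof
    fix Q assume Q: "Q \<in> closed_segment (vs ! i) (vs ! Suc i)"
    have "snd Q \<le> y'" if "(fst Q, y') \<in> ?H" for y'
      using aboveH[OF i that] closed_segment_on_line(1)[OF Q inc[OF i]] by simp
    then show "Q \<in> newton_polygon p h"
      using Q segH[OF i] by (auto simp: newton_polygon_def case_prod_beta)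
  qed
  have "set vs \<subseteq> ?U"
  proof
    fix v assume "v \<in> set vs"
    then obtain i where i: "i < length vs" "v = vs ! i" by (auto simp: in_set_conv_nth)
    show "v \<in> ?U"
    proof (cases "Suc i < length vs")
      case False
      \<comment> \<open>The last vertex starts no edge but ends the previous one, which exists as
        there are at least two vertices.\<close>
      then have "Suc (i - 1) = i" "Suc (i - 1) < length vs" using i len by auto
      then show ?thesis using i by (auto intro!: exI[of _ "i - 1"])
    qed (use i in auto)
  qed
  moreover have "newton_polygon p h \<subseteq> ?U"
  proof
    fix Q assume QP: "Q \<in> newton_polygon p h"
    then have QH: "Q \<in> ?H" by (auto simp: newton_polygon_def)
    have "fst (vs ! 0) \<le> fst Q \<and> fst Q \<le> fst (vs ! (length vs - 1))"
      by (rule hull_fst_bounds[OF range QH])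
    moreover have "length vs - 1 \<ge> 1" using len by simp
    ultimately obtain i where i: "i < length vs - 1" "fst (vs ! i) \<le> fst Q" "fst Q \<le> fst (vs ! Suc i)"
      using exists_consecutive_between[of "\<lambda>i. fst (vs ! i)" "fst Q" "length vs - 1"] by blast
    then have i': "Suc i < length vs" by simp
    define y where "y = snd (vs ! i) + edge_slope (vs ! i) (vs ! Suc i) * (fst Q - fst (vs ! i))"
    have y: "(fst Q, y) \<in> closed_segment (vs ! i) (vs ! Suc i)"
      unfolding y_def using inc[OF i'] i by (intro closed_segment_above)
    then have "snd Q \<le> y" using QP segH[OF i'] by (auto simp: newton_polygon_def)
    moreover have "y \<le> snd Q" using aboveH[OF i' QH] by (simp add: y_def)
    ultimately have "Q = (fst Q, y)" by (simp add: prod_eq_iff)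
    then show "Q \<in> ?U" using y i' by auto
  qed
  ultimately have "newton_polygon p h = set vs \<union> ?U" using segP by blast
  then show ?thesis using h0 inc slopes by (simp add: newton_vertices_def)
qed

lemma newton_points_fst: "P \<in> newton_points p h \<Longrightarrow> 0 \<le> fst P \<and> fst P \<le> real (degree h)"
  by (auto simp: newton_points_def)

lemma newton_pointI:
  assumes "k \<le> degree h" and "padic_val p (coeff h k) = ereal y"
  shows "(real (degree h) - real k, y) \<in> newton_points p h"
  using assms by (auto simp: newton_points_def of_nat_diff intro!: exI[of _ k])

lemma newton_pointE:
  assumes "P \<in> newton_points p h"
  obtains k y where "k \<le> degree h" "P = (real (degree h) - real k, y)"
    "padic_val p (coeff h k) = ereal y"
  using assms by (auto simp: newton_points_def of_nat_diff)

text \<open>The line through an edge supports all Newton points; the bound is its height at abscissa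
  \<open>degree h\<close>, where the constant coefficient sits.\<close>

lemma newton_vertices_gauss_bound:
  assumes nv: "newton_vertices p h vs" and i: "Suc i < length vs"
    and s: "s = edge_slope (vs ! i) (vs ! Suc i)"
  shows "gauss_bound p s (snd (vs ! i) + s * (real (degree h) - fst (vs ! i))) h"
  unfolding gauss_bound_def
proof
  fix k
  show "ereal (snd (vs ! i) + s * (real (degree h) - fst (vs ! i)) - s * real k) \<le> padic_val p (coeff h k)"
  proof (cases "coeff h k = 0")
    case False
    define y where "y = real_of_ereal (padic_val p (coeff h k))"
    have y: "padic_val p (coeff h k) = ereal y"
      using padic_val_nonzero[OF False] by (simp add: y_def)
    have "(real (degree h) - real k, y) \<in> newton_points p h"
      using False y by (intro newton_pointI) (auto intro: le_degree)
    from newton_vertices_above_edge[OF nv i this] show ?thesis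
      by (simp add: y s algebra_simps)
  qed simp
qed

text \<open>The definition does not say where the first vertex lies; for a unit leading coefficient it is
  the origin, the only point of the hull on the vertical axis.\<close>

lemma newton_first_slope_gauss_bound:
  assumes fs: "newton_first_slope p f lam" and u: "padic_val p (lead_coeff f) = 0"
  shows "degree f \<ge> 1" and "gauss_bound p lam (lam * real (degree f)) f" and "poly f 0 \<noteq> 0"
proof -
  obtain v w vs where nv: "newton_vertices p f (v # w # vs)" and lam: "lam = edge_slope v w"
    using fs by (auto simp: newton_first_slope_def)
  show "poly f 0 \<noteq> 0" using nv by (simp add: newton_vertices_def)
  let ?H = "convex hull newton_points p f"
  have vw: "fst v < fst w" using newton_vertices_fst_less[OF nv, of 0] by simp
  have seg: "closed_segment v w \<subseteq> newton_polygon p f"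
    using newton_vertices_edge_subset[OF nv, of 0] by simp
  have vP: "v \<in> newton_polygon p f" and wP: "w \<in> newton_polygon p f" using seg by auto
  then have vH: "v \<in> ?H" and wH: "w \<in> ?H" by (auto simp: newton_polygon_def)
  have v0: "0 \<le> fst v" and "fst w \<le> real (degree f)"
    using hull_fst_bounds[OF newton_points_fst vH] hull_fst_bounds[OF newton_points_fst wH] by auto
  then have "real (degree f) > 0" using vw by linarith
  then show "degree f \<ge> 1" by simp
  \<comment> \<open>\<open>C\<close> is large enough for the line of slope \<open>- C\<close>
    through the origin to support the hull: every Newton point other than the origin has abscissa at
    least 1. Zero coefficients add 0 to the sum.\<close>
  define C where "C = (\<Sum>k\<le>degree f. \<bar>real_of_ereal (padic_val p (coeff f k))\<bar>)"
  have bound: "(- C) * fst P + 0 \<le> snd P" if PH: "P \<in> ?H" for P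
  proof (rule hull_above_line[OF _ PH])
    fix P assume "P \<in> newton_points p f"
    then obtain k y where k: "k \<le> degree f" "P = (real (degree f) - real k, y)"
      "padic_val p (coeff f k) = ereal y" by (rule newton_pointE)
    show "(- C) * fst P + 0 \<le> snd P"
    proof (cases "k = degree f")
      case True
      then show ?thesis using k u by (simp add: zero_ereal_def)
    next
      case False
      have "\<bar>real_of_ereal (padic_val p (coeff f k))\<bar> \<le> C"
        unfolding C_def using k
        by (intro member_le_sum[of k _ "\<lambda>k. \<bar>real_of_ereal (padic_val p (coeff f k))\<bar>"])
          (auto simp del: abs_real_of_ereal)
      then have y: "\<bar>y\<bar> \<le> C" using k by simp
      have "C * 1 \<le> C * (real (degree f) - real k)"
        using y k False by (intro mult_left_mono) auto
      then show ?thesis using k y by simp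
    qed
  qed
  have OS: "(0, 0) \<in> newton_points p f"
    using newton_pointI[of "degree f" f p 0] u by (simp add: zero_ereal_def)
  have OH: "(0, 0) \<in> ?H" using OS by (rule hull_inc)
  have OP: "(0, 0) \<in> newton_polygon p f"
    using OH bound by (fastforce simp: newton_polygon_def)
  have mono: "fst v \<le> fst ((v # w # vs) ! i)" if "i < length (v # w # vs)" for i
    using that
  proof (induction i)
    case (Suc i)
    then show ?case using newton_vertices_fst_less[OF nv, of i] by fastforce
  qed simp
  \<comment> \<open>The origin lies on the polygon, hence on a listed vertex or edge, and none of
    these reaches to the left of \<open>v\<close>.\<close>
  have "fst v \<le> 0"
  proof -
    have "(0, 0) \<in> set (v # w # vs) \<or>
        (\<exists>i. Suc i < length (v # w # vs) \<and>
          (0, 0) \<in> closed_segment ((v # w # vs) ! i) ((v # w # vs) ! Suc i))"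
      using OP nv unfolding newton_vertices_def by blast
    then show ?thesis
    proof
      assume "(0, 0) \<in> set (v # w # vs)"
      then obtain i where "i < length (v # w # vs)" "(v # w # vs) ! i = (0, 0)"
        unfolding in_set_conv_nth by blast
      then show ?thesis using mono[of i] by simp
    next
      assume "\<exists>i. Suc i < length (v # w # vs) \<and>
          (0, 0) \<in> closed_segment ((v # w # vs) ! i) ((v # w # vs) ! Suc i)"
      then obtain i where i: "Suc i < length (v # w # vs)"
          "(0, 0) \<in> closed_segment ((v # w # vs) ! i) ((v # w # vs) ! Suc i)" by blast
      show ?thesis
        using closed_segment_on_line(2)[OF i(2) newton_vertices_fst_less[OF nv i(1)]]
          mono[of i] i(1) by simp
    qed
  qed
  then have fv: "fst v = 0" using v0 by simp
  have "snd v \<le> 0" using vP OH fv by (auto simp: newton_polygon_def)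
  moreover have "0 \<le> snd v" using bound[OF vH] fv by simp
  ultimately have "snd v = 0" by simp
  then show "gauss_bound p lam (lam * real (degree f)) f"
    using newton_vertices_gauss_bound[OF nv, of 0 lam] fv lam by simp
qed

text \<open>Turning a supporting line through the origin clockwise keeps it below all points, as
  their abscissae are nonnegative.\<close>

lemma gauss_bound_smaller_weight:
  assumes f: "gauss_bound p lam (lam * real (degree f)) f" and u: "u \<le> lam"
  shows "gauss_bound p u (real (degree f) * u) f"
  unfolding gauss_bound_def
proof
  fix k
  show "ereal (real (degree f) * u - u * real k) \<le> padic_val p (coeff f k)"
  proof (cases "k \<le> degree f")
    case True
    have "u * (real (degree f) - real k) \<le> lam * (real (degree f) - real k)"
      using u True by (intro mult_right_mono) auto
    then have "ereal (real (degree f) * u - u * real k) \<le> ereal (lam * real (degree f) - lam * real k)"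
      by (simp add: algebra_simps)
    also have "\<dots> \<le> padic_val p (coeff f k)" using f by (simp add: gauss_bound_def)
    finally show ?thesis .
  qed (simp add: coeff_eq_0)
qed

text \<open>The open upper half-plane together with the origin is convex and contains all Newton
  points.\<close>

lemma newton_polygon_snd_pos:
  assumes pos: "\<And>i. i < degree h \<Longrightarrow> padic_val p (coeff h i) > 0"
    and u: "padic_val p (lead_coeff h) = 0"
    and Q: "Q \<in> newton_polygon p h" and "fst Q > 0"
  shows "snd Q > 0"
proof -
  let ?K = "{P :: real \<times> real. P = (0, 0) \<or> snd P > 0}"
  have "convex ?K"
  proof (rule convexI)
    fix P R :: "real \<times> real" and a b :: real
    assume "P \<in> ?K" "R \<in> ?K" and ab: "0 \<le> a" "0 \<le> b" "a + b = 1"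
    then have P: "P = (0, 0) \<or> snd P > 0" and R: "R = (0, 0) \<or> snd R > 0" by auto
    have sP: "snd P \<ge> 0" and sR: "snd R \<ge> 0" using P R by auto
    have n: "a * snd P \<ge> 0" "b * snd R \<ge> 0" using ab sP sR by auto
    show "a *\<^sub>R P + b *\<^sub>R R \<in> ?K"
    proof (cases "a * snd P > 0 \<or> b * snd R > 0")
      case True
      then show ?thesis using n by auto
    next
      case False
      then have "(a = 0 \<or> P = (0, 0)) \<and> (b = 0 \<or> R = (0, 0))"
        using P R ab by (auto simp: zero_less_mult_iff)
      then have "a *\<^sub>R P = 0 \<and> b *\<^sub>R R = 0" by (auto simp: zero_prod_def)
      then show ?thesis by (simp add: zero_prod_def)
    qed
  qed
  moreover have "newton_points p h \<subseteq> ?K"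
  proof
    fix P assume "P \<in> newton_points p h"
    then obtain k y where "k \<le> degree h" "P = (real (degree h) - real k, y)"
      "padic_val p (coeff h k) = ereal y" by (rule newton_pointE)
    then show "P \<in> ?K" using pos[of k] u by (cases "k = degree h") (auto simp: zero_ereal_def)
  qed
  ultimately have "convex hull newton_points p h \<subseteq> ?K" by (intro hull_minimal)
  moreover have "Q \<in> convex hull newton_points p h" using Q by (auto simp: newton_polygon_def)
  ultimately show ?thesis using \<open>fst Q > 0\<close> by auto
qed


section \<open>The composition with an iterate\<close>

theorem theorem1p2:
  fixes p d e t n :: nat and f g :: "rat poly" and m :: "nat \<Rightarrow> nat"
    and \<nu> :: "rat \<Rightarrow> real" and l :: "nat \<Rightarrow> real" and lam :: real
  defines "\<nu> \<equiv> \<lambda>x. real_of_ereal (padic_val p x)"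
  assumes "prime p"
    and "degree g = e" and "coeff g 0 \<noteq> 0"
    and "padic_val p (coeff g e) = 0"
    and "\<forall>i<e. padic_val p (coeff g i) > 0"
    and "t \<ge> 1" and "m 0 = e" and "m t = 0"
    and "newton_vertices p g
           ([(0, 0)] @ map (\<lambda>i. (real e - real (m i), \<nu> (coeff g (m i)))) [1..<t]
            @ [(real e, \<nu> (coeff g 0))])"
    and "\<forall>i. 1 \<le> i \<and> i \<le> t \<longrightarrow>
           l i = (\<nu> (coeff g (m i)) - \<nu> (coeff g (m (i - 1)))) / (real (m (i - 1)) - real (m i))"
    and "degree f = d"
    and "newton_first_slope p f lam" and "lam \<ge> l 1"
    and "padic_val p (lead_coeff f) = 0"
    and "\<nu> (coeff g 0) < l 1 * (real d + real e - 1) \<or>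
         \<nu> (coeff g 0) = l 1 * (real d + real e - 1) \<and> (\<nu> (poly f 0) > real d * lam \<or> lam > l 1)"
    and "n \<ge> 1"
  shows "newton_vertices p (pcompose g (poly_iterate f n))
           ([(0, 0)]
            @ map (\<lambda>i. (real d ^ n * (real e - real (m i)), \<nu> (coeff g (m i)))) [1..<t]
            @ [(real d ^ n * real e, \<nu> (coeff g 0))])"
proof -
  note p = \<open>prime p\<close> and deg_g = \<open>degree g = e\<close> and deg_f = \<open>degree f = d\<close>
    and m0 = \<open>m 0 = e\<close> and mt = \<open>m t = 0\<close> and t1 = \<open>t \<ge> 1\<close> and n1 = \<open>n \<ge> 1\<close>
    and l1_lam = \<open>lam \<ge> l 1\<close> and g_unit = \<open>padic_val p (coeff g e) = 0\<close>
    and f_unit = \<open>padic_val p (lead_coeff f) = 0\<close>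

  \<comment> \<open>Vertices, slopes and supporting lines of \<open>g\<close>\<close>
  define V where "V i = \<nu> (coeff g (m i))" for i
  define P where "P i = (real e - real (m i), V i)" for i
  have V0: "V 0 = 0" using m0 g_unit by (simp add: V_def \<nu>_def)
  \<comment> \<open>The statement lists the two end vertices separately; \<open>V 0 = 0\<close>,
    \<open>m 0 = e\<close> and \<open>m t = 0\<close> make them values of \<open>P\<close> as
    well.\<close>
  have upt: "[0..<Suc t] = 0 # [1..<t] @ [t]" using t1 by (simp add: upt_conv_Cons)
  have nv: "newton_vertices p g (map P [0..<Suc t])"
    using assms(10) unfolding upt by (simp add: P_def[abs_def] V0 m0 mt) (simp add: V_def[abs_def] mt)
  have nthP: "map P [0..<Suc t] ! i = P i" if "i \<le> t" for i
    using that by (simp del: upt_Suc)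
  have mdec: "m (Suc i) < m i" if "i < t" for i
    using newton_vertices_fst_less[OF nv, of i] that by (simp add: nthP P_def del: upt_Suc)
  have slope: "edge_slope (P i) (P (Suc i)) = l (Suc i)" if "i < t" for i
    using assms(11)[rule_format, of "Suc i"] that by (simp add: edge_slope_def P_def V_def)
  have VSuc: "V (Suc i) = V i + l (Suc i) * (real (m i) - real (m (Suc i)))" if "i < t" for i
    using slope[OF that] mdec[OF that] by (simp add: edge_slope_def P_def field_simps)
  have linc: "l (Suc i) < l (Suc (Suc i))" if "Suc i < t" for i
  proof -
    have "edge_slope (P i) (P (Suc i)) < edge_slope (P (Suc i)) (P (Suc (Suc i)))"
      using nv that unfolding newton_vertices_def by (auto simp: nthP simp del: upt_Suc)
    then show ?thesis using that by (simp add: slope)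
  qed
  have lmono: "l (Suc i) \<le> l (Suc j)" if "i \<le> j" "j < t" for i j
    using that by (induction j rule: dec_induct) (use linc in \<open>fastforce+\<close>)
  have gb: "gauss_bound p (l (Suc i)) (V i + l (Suc i) * real (m i)) g" if "i < t" for i
    using newton_vertices_gauss_bound[OF nv, of i "l (Suc i)"] that
    by (simp add: nthP slope deg_g del: upt_Suc) (simp add: P_def)
  have mlt: "m i < e" if "1 \<le> i" "i \<le> t" for i
    using that
  proof (induction i rule: dec_induct)
    case base
    then show ?case using mdec[of 0] m0 t1 by simp
  next
    case (step i)
    then show ?case using mdec[of i] by simp
  qed
  have Vpos: "V i > 0" if i: "1 \<le> i" "i \<le> t" for i
  proof -
    have "P i \<in> set (map P [0..<Suc t])" using i by (auto simp del: upt_Suc)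
    then have "P i \<in> newton_polygon p g" using nv unfolding newton_vertices_def by blast
    then show ?thesis
      using newton_polygon_snd_pos[of g p "P i"] assms(6) g_unit mlt[OF i] by (simp add: deg_g P_def)
  qed
  \<comment> \<open>\<open>\<nu>\<close> sends \<infinity> to the default value 0, so positivity of
    \<open>V i\<close> is what excludes a zero coefficient.\<close>
  have Vval: "padic_val p (coeff g (m i)) = ereal (V i)" if "i \<le> t" for i
  proof (cases "i = 0")
    case False
    then have "V i > 0" using Vpos that by simp
    then have "coeff g (m i) \<noteq> 0" by (auto simp: V_def \<nu>_def)
    then show ?thesis using padic_val_nonzero by (simp add: V_def \<nu>_def)
  qed (simp add: V0 m0 g_unit)
  have l1: "l 1 > 0"
    using VSuc[of 0] Vpos[of 1] V0 m0 mlt[of 1] t1 by (simp add: zero_less_mult_iff)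
  have lpos: "l (Suc i) > 0" if "i < t" for i
    using lmono[of 0 i] l1 that by simp

  \<comment> \<open>Comparing the last slope of \<open>g\<close> with \<open>d lam\<close>\<close>
  have ltV: "l t + l 1 * (real e - 1) \<le> V t"
  proof -
    define k where "k = t - 1"
    have k: "k < t" "Suc k = t" using t1 by (auto simp: k_def)
    have "ereal (l 1 * real e - l 1 * real (m k)) \<le> ereal (V k)"
      using gb[of 0] t1 Vval[of k] k unfolding gauss_bound_def by (simp add: V0 m0 flip: Vval)
    then have "l 1 * real e - l 1 * real (m k) \<le> V k" by simp
    moreover have "V t = V k + l t * real (m k)" using VSuc[of k] k mt by simp
    \<comment> \<open>The last edge has length \<open>m k \<ge> 1\<close>: one unit keeps the slope
      \<open>l t\<close>, and the rest is estimated by \<open>l 1\<close>.\<close>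
    moreover have "l 1 * (real (m k) - 1) \<le> l t * (real (m k) - 1)"
      using lmono[of 0 k] mdec[of k] k by (intro mult_right_mono) auto
    ultimately show ?thesis by (simp add: algebra_simps)
  qed
  have d1: "d \<ge> 1" and f_bound: "gauss_bound p lam (lam * real d) f" and f0: "poly f 0 \<noteq> 0"
    using newton_first_slope_gauss_bound[OF assms(13) f_unit] deg_f by auto
  have lam0: "lam > 0" using l1 l1_lam by simp
  have l1d: "l 1 * real d \<le> real d * lam"
    using mult_right_mono[OF l1_lam, of "real d"] by (simp add: mult.commute)
  \<comment> \<open>Condition (i), and (ii) with \<open>lam > l 1\<close>, give the strict
    inequality. The remaining case of (ii) allows equality but supplies the bound on
    \<open>f(0)\<close>.\<close>
  have cond: "l t < real d * lam \<or> l t \<le> real d * lam \<and> \<nu> (poly f 0) > real d * lam"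
  proof -
    have Vt: "V t = \<nu> (coeff g 0)" by (simp add: V_def mt)
    have *: "l 1 * (real d + real e - 1) = l 1 * real d + l 1 * (real e - 1)"
      by (simp add: algebra_simps)
    have "l 1 * real d < real d * lam" if "lam > l 1"
      using that d1 by (simp add: mult.commute)
    then show ?thesis using assms(16) ltV l1d unfolding * Vt by linarith
  qed
  then have lt_dlam: "l t \<le> real d * lam" by auto
  have l_dlam: "l (Suc i) \<le> real d * lam" if "i < t" for i
  proof -
    have "l (Suc i) \<le> l (Suc (t - 1))" using that by (intro lmono) auto
    then show ?thesis using lt_dlam t1 by simp
  qed

  \<comment> \<open>Gauss bounds and vertex coefficients of the composition\<close>
  define F where "F = poly_iterate f n"
  define D where "D = d ^ n"
  have D1: "real D > 0" using d1 by (simp add: D_def)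
  have degF: "degree F = D" by (simp add: F_def D_def degree_poly_iterate deg_f)
  have F_unit: "padic_val p (lead_coeff F) = 0"
    unfolding F_def using d1 deg_f f_unit by (intro padic_val_lead_coeff_poly_iterate p) auto
  have F_bound: "gauss_bound p (s / real D) s F" if s: "0 \<le> s" "s \<le> real d * lam" for s
  proof -
    have "s / real D * real d ^ k \<le> lam" if "k < n" for k
    proof -
      \<comment> \<open>Multiplying by \<open>d\<close> raises the exponent to
        \<open>k + 1 \<le> n\<close>, so that division by \<open>D = d^n\<close> leaves at most
        \<open>s\<close>.\<close>
      have "real d * (s / real D * real d ^ k) = s * (real d ^ Suc k / real D)" by simp
      also have "\<dots> \<le> s * 1"
      proof (rule mult_left_mono)
        have "real d ^ Suc k \<le> real d ^ n" using that d1 by (intro power_increasing) auto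
        then show "real d ^ Suc k / real D \<le> 1" using D1 by (simp add: D_def)
      qed (use s in simp)
      finally have "real d * (s / real D * real d ^ k) \<le> real d * lam" using s by simp
      then show ?thesis by (rule mult_left_le_imp_le) (use d1 in simp)
    qed
    then have "gauss_bound p (s / real D) (s / real D * real d ^ n) F"
      unfolding F_def
      using gauss_bound_smaller_weight[of p lam f] f_bound deg_f
      by (intro gauss_bound_poly_iterate[OF p]) auto
    then show ?thesis using D1 d1 by (simp add: D_def)
  qed

  define h where "h = pcompose g F"
  have degh: "degree h = D * e" by (simp add: h_def degree_pcompose deg_g degF mult.commute)
  \<comment> \<open>Composition stretches the supporting lines of \<open>g\<close> horizontally by
    \<open>D\<close>: slopes are divided by \<open>D\<close>, the bounds stay.\<close>
  have h_bound: "gauss_bound p (l (Suc i) / real D) (V i + l (Suc i) * real (m i)) h" if "i < t" for i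
    unfolding h_def using F_bound[of "l (Suc i)"] lpos[OF that] l_dlam[OF that]
    by (intro gauss_bound_pcompose[OF p gb[OF that]]) auto

  have F0: "ereal (l t) < padic_val p (poly F 0)"
  proof (cases "l t < real d * lam")
    case True
    then have "ereal (l t) < ereal (real d * lam)" by simp
    also have "\<dots> \<le> padic_val p (poly F 0)"
      unfolding F_def using f_bound d1 lam0 n1
      by (intro padic_val_poly_iterate_0_ge[OF p]) (auto simp: mult.commute)
    finally show ?thesis .
  next
    case False
    then have "\<nu> (poly f 0) > real d * lam" using cond by simp
    then have "ereal (real d * lam) < ereal (\<nu> (poly f 0))" by simp
    also have "\<dots> = padic_val p (coeff f 0)"
      using padic_val_nonzero[OF f0] by (simp add: \<nu>_def poly_0_coeff_0)
    finally have a0: "ereal (real d * lam) < padic_val p (coeff f 0)" .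
    have "ereal (l t) \<le> ereal (real d * lam)" using lt_dlam by simp
    also have "\<dots> < padic_val p (poly F 0)"
      unfolding F_def using f_bound d1 lam0 n1 a0
      by (intro padic_val_poly_iterate_0_gt[OF p]) (auto simp: mult.commute)
    finally show ?thesis .
  qed
  have h0: "padic_val p (poly h 0) = ereal (V t)"
  proof -
    \<comment> \<open>Since \<open>m t = 0\<close>, the bound belonging to the last edge is attained
      by the constant term.\<close>
    have "gauss_bound p (l t) (V t) g"
      using gb[of "t - 1"] VSuc[of "t - 1"] t1 mt by simp
    then show ?thesis
      unfolding h_def poly_pcompose using F0 Vval[of t] mt
      by (intro padic_val_poly_eq_constant[OF p]) auto
  qed
  have h_coeff: "padic_val p (coeff h (D * m i)) = ereal (V i)" if i: "i \<le> t" for i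
  proof -
    consider "i = 0" | "i = t" | k where "i = Suc k" "Suc k < t"
      using i by (cases i) fastforce+
    then show ?thesis
    proof cases
      case 1
      have "lead_coeff h = lead_coeff g * lead_coeff F ^ degree g"
        unfolding h_def using degF D1 by (intro lead_coeff_comp) auto
      then show ?thesis
        using degh 1 m0 V0 g_unit deg_g
        by (simp add: padic_val_mult[OF p] padic_val_power_unit[OF p F_unit])
    next
      case 2
      then show ?thesis using h0 mt by (simp add: poly_0_coeff_0)
    next
      case 3
      \<comment> \<open>Any slope strictly between those of the two adjacent edges would do: its
        line through the vertex meets no other Newton point of \<open>g\<close>.\<close>
      define s where "s = (l (Suc k) + l (Suc (Suc k))) / 2"
      have s: "l (Suc k) < s" "s < l (Suc (Suc k))" using linc[of k] 3 by (auto simp: s_def)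
      have s0: "0 \<le> s" "s \<le> real d * lam" using s lpos[of k] l_dlam[of "Suc k"] 3 by auto
      show ?thesis unfolding h_def
      proof (rule padic_val_coeff_pcompose_eq[OF p degF F_unit])
        show "gauss_bound p (s / real D) (s / real D * real D) F"
          using F_bound[OF s0] D1 by simp
        show "m i \<le> degree g" using mlt[of i] 3 i deg_g by simp
        show "padic_val p (coeff g (m i)) = ereal (V i)" using Vval i by simp
        fix j assume j: "j \<le> degree g" "j \<noteq> m i"
        have "ereal (V i + s * (real (m i) - real j)) < padic_val p (coeff g j)"
        \<comment> \<open>Smaller indices lie to the right of the vertex and are controlled by the
          following edge, larger ones by the preceding edge.\<close>
        proof (cases "j < m i")
          case True
          have "ereal (V i + s * (real (m i) - real j))
              < ereal (V i + l (Suc (Suc k)) * (real (m i) - real j))"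
            using s True by simp
          also have "\<dots> = ereal (V i + l (Suc i) * real (m i) - l (Suc i) * real j)"
            using 3 by (simp add: algebra_simps)
          also have "\<dots> \<le> padic_val p (coeff g j)"
            using gb[of i] 3 unfolding gauss_bound_def by blast
          finally show ?thesis .
        next
          case False
          have "s * (real (m i) - real j) < l (Suc k) * (real (m i) - real j)"
            using s False j by (intro mult_strict_right_mono_neg) auto
          then have "ereal (V i + s * (real (m i) - real j))
              < ereal (V i + l (Suc k) * (real (m i) - real j))" by simp
          also have "\<dots> = ereal (V k + l (Suc k) * real (m k) - l (Suc k) * real j)"
            using VSuc[of k] 3 by (simp add: algebra_simps)
          also have "\<dots> \<le> padic_val p (coeff g j)"
            using gb[of k] 3 unfolding gauss_bound_def by simp
          finally show ?thesis .
        qed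
        then show "ereal (V i + s / real D * real D * (real (m i) - real j)) < padic_val p (coeff g j)"
          using D1 by simp
      qed
    qed
  qed

  \<comment> \<open>Assembling the polygon of the composition\<close>
  define Q where "Q i = (real D * (real e - real (m i)), V i)" for i
  have nthQ: "map Q [0..<Suc t] ! i = Q i" if "i \<le> t" for i
    using that by (simp del: upt_Suc)
  have slopeQ: "edge_slope (Q i) (Q (Suc i)) = l (Suc i) / real D" if "i < t" for i
  proof -
    have "fst (Q (Suc i)) - fst (Q i) = real D * (real (m i) - real (m (Suc i)))"
      by (simp add: Q_def algebra_simps)
    then show ?thesis
      using VSuc[OF that] mdec[OF that] D1 by (simp add: edge_slope_def) (simp add: Q_def)
  qed
  have m_le: "m i \<le> e" if "i \<le> t" for i
    using mlt[of i] m0 that by (cases "i = 0") auto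
  have "newton_vertices p h (map Q [0..<Suc t])"
  proof (rule newton_verticesI)
    show "poly h 0 \<noteq> 0" using h0 by auto
    show "length (map Q [0..<Suc t]) \<ge> 2" using t1 by simp
    show "set (map Q [0..<Suc t]) \<subseteq> newton_points p h"
    proof
      fix v assume "v \<in> set (map Q [0..<Suc t])"
      then obtain i where i: "i \<le> t" "v = Q i" by (auto simp: less_Suc_eq_le simp del: upt_Suc)
      have "D * m i \<le> degree h" using m_le[OF i(1)] degh by simp
      from newton_pointI[OF this h_coeff[OF i(1)]] show "v \<in> newton_points p h"
        using i by (simp add: Q_def degh algebra_simps)
    qed
  next
    fix R assume "R \<in> newton_points p h"
    then show "fst (map Q [0..<Suc t] ! 0) \<le> fst R \<and>
        fst R \<le> fst (map Q [0..<Suc t] ! (length (map Q [0..<Suc t]) - 1))"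
      using newton_points_fst[of R p h] by (simp add: nthQ degh del: upt_Suc) (simp add: Q_def m0 mt)
  next
    fix i R assume i: "Suc i < length (map Q [0..<Suc t])" and "R \<in> newton_points p h"
    then obtain k y where R: "R = (real (degree h) - real k, y)"
      "padic_val p (coeff h k) = ereal y" by (auto elim: newton_pointE)
    have "ereal (V i + l (Suc i) * real (m i) - l (Suc i) / real D * real k) \<le> ereal y"
      using h_bound[of i] i R(2) unfolding gauss_bound_def by (metis length_map length_upt Suc_less_eq diff_zero)
    \<comment> \<open>As \<open>degree h = D e\<close>, the line through \<open>Q i\<close> of slope
      \<open>l (Suc i) / D\<close> is exactly the one expressed by \<open>h_bound\<close>.\<close>
    moreover have "V i + l (Suc i) / real D * (fst R - real D * (real e - real (m i)))
        = V i + l (Suc i) * real (m i) - l (Suc i) / real D * real k"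
      using D1 by (simp add: R degh field_simps)
    ultimately show "snd (map Q [0..<Suc t] ! i) +
        edge_slope (map Q [0..<Suc t] ! i) (map Q [0..<Suc t] ! Suc i) *
        (fst R - fst (map Q [0..<Suc t] ! i)) \<le> snd R"
      using i by (simp add: nthQ slopeQ del: upt_Suc) (simp add: Q_def R)
  next
    fix i assume "Suc i < length (map Q [0..<Suc t])"
    then show "fst (map Q [0..<Suc t] ! i) < fst (map Q [0..<Suc t] ! Suc i)"
      using mdec[of i] D1 by (simp add: nthQ del: upt_Suc) (simp add: Q_def)
  next
    fix i assume "Suc (Suc i) < length (map Q [0..<Suc t])"
    then show "edge_slope (map Q [0..<Suc t] ! i) (map Q [0..<Suc t] ! Suc i) <
        edge_slope (map Q [0..<Suc t] ! Suc i) (map Q [0..<Suc t] ! Suc (Suc i))"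
      using linc[of i] D1 by (simp add: nthQ slopeQ divide_strict_right_mono del: upt_Suc)
  qed
  then show ?thesis
    unfolding upt by (simp add: Q_def[abs_def] V0 m0 mt D_def h_def F_def) (simp add: V_def[abs_def] mt)
qed

end
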